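(* Let $q\ge2$ and $r$ be integers with $1\le r\le q-1$. Then the function $$\psi(u,r,q)=-\sum_{\substack{|n|\ge1\\ n\equiv r\ (\mathrm{mod}\ q)}}\frac{e^{2\pi i n u}}{2\pi i n}$$ is a periodic step function of $u$ with period $1$, and for $0<u\le1$, $$\psi(u,r,q)=c(r,q)-\frac1q\Big(\frac12+{\sum_{1\le \ell\le qu}}' e^{\frac{2\pi i \ell r}{q}}\Big),$$ where the prime on the sum means that, if $qu$ is an integer, the term with $\ell=qu$ is to be halved, and $$c(r,q)=-\frac{1}{2\pi i}\Big(\frac1r-2r\sum_{m\ge1}\frac{1}{m^2q^2-r^2}\Big).$$
   Context: The series defining $\psi(u,r,q)$ is over nonzero integers $n\equiv r\pmod q$ and is understood as the limit as $M\to\infty$ of the partial sums over $n=mq+r$ with $-M\le m\le M$. (The number $c(r,q)$ equals the value $-\sum_{m=-\infty}^{\infty}\frac{1}{2\pi i(mq+r)}$ of the series at integer $u$, summed symmetrically in $m$.) *)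

theory Defs
  imports "HOL-Analysis.Analysis"
begin

text \<open>A step function on the real line: every compact interval has a finite partition such that the
  function is constant on each open piece; the values at the partition points are unrestricted.\<close>

definition step_function :: "(real \<Rightarrow> 'a) \<Rightarrow> bool" where
  "step_function f \<longleftrightarrow>
    (\<forall>a b. a < b \<longrightarrow>
      (\<exists>n (t :: nat \<Rightarrow> real). t 0 = a \<and> t n = b \<and>
        (\<forall>i<n. t i < t (Suc i) \<and> f constant_on {t i<..<t (Suc i)})))"

definition psi_partial :: "real \<Rightarrow> int \<Rightarrow> int \<Rightarrow> nat \<Rightarrow> complex" where
  "psi_partial u r q M =
    - (\<Sum>m | m \<in> {- int M..int M} \<and> m * q + r \<noteq> 0.
        exp (2 * of_real pi * \<i> * of_int (m * q + r) * of_real u)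
          / (2 * of_real pi * \<i> * of_int (m * q + r)))"

text \<open>The series over nonzero \<open>n \<equiv> r (mod q)\<close> converges only conditionally. It is summed
  symmetrically in \<open>m\<close>, where \<open>n = m q + r\<close>.\<close>

definition psi :: "real \<Rightarrow> int \<Rightarrow> int \<Rightarrow> complex" where
  "psi u r q = lim (psi_partial u r q)"

definition c_const :: "int \<Rightarrow> int \<Rightarrow> complex" where
  "c_const r q =
    - (1 / (2 * of_real pi * \<i>)) *
      (1 / of_int r - 2 * of_int r * (\<Sum>m. 1 / (of_nat (Suc m) ^ 2 * of_int q ^ 2 - of_int r ^ 2)))"

definition primed_sum :: "real \<Rightarrow> int \<Rightarrow> int \<Rightarrow> complex" where
  "primed_sum u r q =
    (\<Sum>l | 1 \<le> l \<and> real_of_int l \<le> real_of_int q * u.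
      (if real_of_int l = real_of_int q * u then 1 / 2 else 1) *
      exp (2 * of_real pi * \<i> * of_int l * of_int r / of_int q))"

end

theory Submission
  imports Defs "HOL-Real_Asymp.Real_Asymp"
begin

text \<open>The congruence condition \<open>n \<equiv> r (mod q)\<close> is detected by averaging over the \<open>q\<close>-th roots of
  unity, which turns \<open>psi\<close> into \<open>1/q\<close> times the sum of \<open>e(l r / q) s(u - l/q)\<close> over
  \<open>1 \<le> l \<le> q\<close>, where \<open>e(x) = exp(2 \<pi> i x)\<close> and \<open>s\<close> is the sawtooth function. Between
  consecutive multiples of \<open>1/q\<close> each \<open>s(u - l/q)\<close> is \<open>u\<close> plus a constant, and the terms linear
  in \<open>u\<close> cancel because the nontrivial \<open>q\<close>-th roots of unity sum to zero; at multiples of \<open>1/q\<close>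
  the jumps of \<open>s\<close> give the primed sum. The constant is \<open>psi\<close> at \<open>0\<close>.\<close>

section \<open>The sine series with coefficients \<open>1/k\<close>\<close>

text \<open>Each term \<open>2 * sin (x/2) * cos (k * x)\<close> is a difference of sines at
  consecutive half-integer multiples of \<open>x\<close>, so the sum telescopes. This evaluates the
  derivative of the partial sums of the sine series.\<close>

lemma dirichlet_kernel:
  fixes x :: real
  shows "2 * sin (x/2) * (\<Sum>k=1..N. cos (real k * x)) = sin ((real N + 1/2) * x) - sin (x/2)"
proof (induction N)
  case (Suc N)
  have "2 * sin (x/2) * cos (real (Suc N) * x)
      = sin ((real (Suc N) + 1/2) * x) - sin ((real N + 1/2) * x)"
  proof -
    have 1: "(real (Suc N) + 1/2) * x = real (Suc N) * x + x/2"
      and 2: "(real N + 1/2) * x = real (Suc N) * x - x/2"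
      by (simp_all add: field_simps)
    show ?thesis unfolding 1 2 by (simp add: sin_add sin_diff)
  qed
  with Suc show ?case by (simp add: distrib_left del: of_nat_Suc)
qed simp

text \<open>As a function of \<open>t\<close>, \<open>sin (t/2)\<close> rises up to
  \<open>pi\<close> and falls after it, symmetrically, so moving from \<open>pi\<close> towards
  \<open>x\<close> it only decreases. This keeps denominators away from zero on the whole segment,
  on whichever side of \<open>pi\<close> the point \<open>x\<close> lies.\<close>

lemma sin_half_ge_between:
  fixes x t :: real
  assumes "0 < x" "x < 2 * pi" "t \<in> closed_segment pi x"
  shows "sin (x/2) \<le> sin (t/2)"
proof (cases "x \<le> pi")
  case True
  with assms show ?thesis
    by (intro sin_monotone_2pi_le) (auto simp: closed_segment_eq_real_ivl split: if_splits)
next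
  case False
  then have "sin (pi - x/2) \<le> sin (pi - t/2)"
    using assms by (intro sin_monotone_2pi_le) (auto simp: closed_segment_eq_real_ivl split: if_splits)
  then show ?thesis by simp
qed

text \<open>Adding \<open>cos ((N + 1/2) x) / ((2 N + 1) sin (x/2))\<close> to the partial sum removes the oscillating
  part of its derivative, up to an error of order \<open>1/N\<close>.\<close>

lemma sine_series_bound:
  fixes x :: real
  assumes x: "0 < x" "x < 2 * pi"
  shows "\<bar>(\<Sum>k=1..N. sin (real k * x) / real k)
            + cos ((real N + 1/2) * x) / ((2 * real N + 1) * sin (x/2)) + x/2 - pi/2\<bar>
          \<le> 1 / (2 * real N + 1) * (\<bar>x - pi\<bar> / (2 * (sin (x/2))\<^sup>2))"
proof -
  define D where "D = 2 * real N + 1"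
  define H where "H t = (\<Sum>k=1..N. sin (real k * t) / real k)
            + cos ((real N + 1/2) * t) / (D * sin (t/2)) + t/2" for t
  define H' where "H' t = - (cos ((real N + 1/2) * t) * cos (t/2)) / (2 * D * (sin (t/2))\<^sup>2)" for t
  have D: "D > 0" by (simp add: D_def)
  have sx: "sin (x/2) > 0" using x by (intro sin_gt_zero) auto
  have spos: "sin (t/2) > 0" if "t \<in> closed_segment pi x" for t
    using sin_half_ge_between[OF x that] sx by linarith
  have deriv: "(H has_real_derivative H' t) (at t within closed_segment pi x)"
    if "t \<in> closed_segment pi x" for t
  proof -
    have s: "sin (t/2) > 0" using spos that .
    have S: "(\<Sum>k=1..N. cos (real k * t)) = (sin ((real N + 1/2) * t) - sin (t/2)) / (2 * sin (t/2))"
      using dirichlet_kernel[of t N] s by (simp add: field_simps)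
    have 1: "((\<lambda>t. \<Sum>k=1..N. sin (real k * t) / real k) has_real_derivative
           (\<Sum>k=1..N. cos (real k * t))) (at t within closed_segment pi x)"
      by (intro DERIV_sum) (auto intro!: derivative_eq_intros)
    have 2: "((\<lambda>t. cos ((real N + 1/2) * t)) has_real_derivative
        - sin ((real N + 1/2) * t) * (real N + 1/2)) (at t within closed_segment pi x)"
      by (auto intro!: derivative_eq_intros)
    have 3: "((\<lambda>t. D * sin (t/2)) has_real_derivative D * (cos (t/2) * (1/2)))
        (at t within closed_segment pi x)"
      by (auto intro!: derivative_eq_intros)
    have 4: "((\<lambda>t. t/2) has_real_derivative 1/2) (at t within closed_segment pi x)"
      by (auto intro!: derivative_eq_intros)
    have "(H has_real_derivative (\<Sum>k=1..N. cos (real k * t)) +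
        (- sin ((real N + 1/2) * t) * (real N + 1/2) * (D * sin (t/2))
          - cos ((real N + 1/2) * t) * (D * (cos (t/2) * (1/2)))) / (D * sin (t/2) * (D * sin (t/2))) + 1/2)
        (at t within closed_segment pi x)"
      unfolding H_def using s D by (intro DERIV_add DERIV_divide 1 2 3 4) auto
    moreover have "(\<Sum>k=1..N. cos (real k * t)) +
        (- sin ((real N + 1/2) * t) * (real N + 1/2) * (D * sin (t/2))
          - cos ((real N + 1/2) * t) * (D * (cos (t/2) * (1/2)))) / (D * sin (t/2) * (D * sin (t/2))) + 1/2
        = H' t"
    proof -
      \<comment> \<open>The factor \<open>D\<close> in the correction term is chosen for this:
        differentiating its numerator gives \<open>- sin ((N + 1/2) * t) / (2 * sin (t/2))\<close>,
        which cancels the oscillating part of the kernel.\<close>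
      have N: "real N + 1/2 = D / 2" by (simp add: D_def field_simps)
      have "(S - w) / (2 * w) + (- S * (D / 2) * (D * w) - C * (D * (c * (1/2)))) / (D * w * (D * w)) + 1/2
          = - (C * c) / (2 * D * w\<^sup>2)" if "w > 0" for S C c w :: real
        using that D by (simp add: field_simps power2_eq_square)
      from this[OF s] show ?thesis unfolding S H'_def N .
    qed
    ultimately show ?thesis by simp
  qed
  have bound: "norm (H' t) \<le> 1 / (2 * D * (sin (x/2))\<^sup>2)" if "t \<in> closed_segment pi x" for t
  proof -
    have "\<bar>cos ((real N + 1/2) * t) * cos (t/2)\<bar> \<le> 1 * 1"
      unfolding abs_mult by (intro mult_mono) auto
    moreover have "(sin (x/2))\<^sup>2 \<le> (sin (t/2))\<^sup>2"
      using sin_half_ge_between[OF x that] sx by (intro power_mono) auto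
    ultimately show ?thesis
      unfolding H'_def using D sx spos[OF that]
      by (simp add: abs_mult) (intro frac_le mult_left_mono, auto)
  qed
  \<comment> \<open>Mean value inequality with base point \<open>pi\<close>, where the sines and the
    correction all vanish and so \<open>H\<close> is known exactly for every
    \<open>N\<close>.\<close>
  have "norm (H x - H pi) \<le> 1 / (2 * D * (sin (x/2))\<^sup>2) * norm (x - pi)"
    by (rule field_differentiable_bound[OF _ deriv bound]) auto
  moreover have "H pi = pi/2"
  proof -
    have "cos ((real N + 1/2) * pi) = 0"
      unfolding distrib_right cos_add by simp
    then show ?thesis by (simp add: H_def)
  qed
  ultimately have "\<bar>H x - pi/2\<bar> \<le> 1 / D * (\<bar>x - pi\<bar> / (2 * (sin (x/2))\<^sup>2))"
    by (simp add: mult_ac)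
  then show ?thesis unfolding H_def D_def .
qed

text \<open>For fixed \<open>x\<close> both the error bound and the cosine correction are
  \<open>O(1/N)\<close>, so the partial sums inherit the limit.\<close>

lemma sine_series:
  fixes x :: real
  assumes x: "0 < x" "x < 2 * pi"
  shows "(\<lambda>N. \<Sum>k=1..N. sin (real k * x) / real k) \<longlonglongrightarrow> (pi - x) / 2"
proof -
  have inv: "(\<lambda>N. 1 / (2 * real N + 1)) \<longlonglongrightarrow> 0"
    by real_asymp
  define E where "E N = (\<Sum>k=1..N. sin (real k * x) / real k)
            + cos ((real N + 1/2) * x) / ((2 * real N + 1) * sin (x/2)) + x/2 - pi/2" for N
  have E: "E \<longlonglongrightarrow> 0"
  proof (rule Lim_null_comparison)
    show "\<forall>\<^sub>F N in sequentially. norm (E N) \<le> 1 / (2 * real N + 1) * (\<bar>x - pi\<bar> / (2 * (sin (x/2))\<^sup>2))"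
      using sine_series_bound[OF x] by (simp add: E_def)
    show "(\<lambda>N. 1 / (2 * real N + 1) * (\<bar>x - pi\<bar> / (2 * (sin (x/2))\<^sup>2))) \<longlonglongrightarrow> 0"
      using tendsto_mult_left_zero[OF inv] .
  qed
  have C: "(\<lambda>N. cos ((real N + 1/2) * x) / ((2 * real N + 1) * sin (x/2))) \<longlonglongrightarrow> 0"
  proof (rule Lim_null_comparison)
    have "norm (cos ((real N + 1/2) * x) / ((2 * real N + 1) * sin (x/2)))
        \<le> 1 / (2 * real N + 1) * (1 / \<bar>sin (x/2)\<bar>)" for N
    proof -
      have "\<bar>cos ((real N + 1/2) * x)\<bar> / ((2 * real N + 1) * \<bar>sin (x/2)\<bar>)
          \<le> 1 / ((2 * real N + 1) * \<bar>sin (x/2)\<bar>)"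
        by (intro divide_right_mono) auto
      then show ?thesis by (simp add: abs_mult)
    qed
    then show "\<forall>\<^sub>F N in sequentially. norm (cos ((real N + 1/2) * x) / ((2 * real N + 1) * sin (x/2)))
        \<le> 1 / (2 * real N + 1) * (1 / \<bar>sin (x/2)\<bar>)" by simp
    show "(\<lambda>N. 1 / (2 * real N + 1) * (1 / \<bar>sin (x/2)\<bar>)) \<longlonglongrightarrow> 0"
      using tendsto_mult_left_zero[OF inv] .
  qed
  have "(\<lambda>N. E N - cos ((real N + 1/2) * x) / ((2 * real N + 1) * sin (x/2)) + (pi - x)/2)
      \<longlonglongrightarrow> 0 - 0 + (pi - x)/2"
    by (intro tendsto_intros E C)
  then show ?thesis by (simp add: E_def field_simps)
qed

section \<open>Additive characters and orthogonality of roots of unity\<close>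

definition unit_exp :: "real \<Rightarrow> complex" where
  "unit_exp x = cis (2 * pi * x)"

lemma unit_exp_add: "unit_exp (x + y) = unit_exp x * unit_exp y"
  by (simp add: unit_exp_def cis_mult distrib_left)

lemma unit_exp_of_int [simp]: "unit_exp (of_int n) = 1"
  by (simp add: unit_exp_def)

lemma unit_exp_0 [simp]: "unit_exp 0 = 1"
  by (simp add: unit_exp_def)

lemma norm_unit_exp [simp]: "norm (unit_exp x) = 1"
  by (simp add: unit_exp_def)

lemma unit_exp_power: "unit_exp x ^ n = unit_exp (real n * x)"
  using Complex.DeMoivre[of "2 * pi * x" n] by (simp add: unit_exp_def mult_ac)

lemma unit_exp_eq_1_imp_Ints:
  assumes "unit_exp x = 1"
  shows "x \<in> \<int>"
proof -
  have "cos (2 * pi * x) = 1"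
    using assms by (simp add: unit_exp_def complex_eq_iff)
  then obtain n :: int where "2 * pi * x = of_int n * 2 * pi"
    by (auto simp: cos_one_2pi_int)
  then have "x = of_int n" by simp
  then show ?thesis by simp
qed

text \<open>A geometric sum whose ratio is a \<open>q\<close>-th root of unity, equal to 1 exactly
  when \<open>q\<close> divides \<open>n\<close>. It serves as the detector of congruences modulo
  \<open>q\<close>.\<close>

lemma sum_unit_exp_eq:
  fixes q n :: int
  assumes q: "q > 0"
  shows "(\<Sum>l=1..q. unit_exp (of_int l * of_int n / of_int q)) = (if q dvd n then of_int q else 0)"
proof -
  define w where "w = unit_exp (of_int n / of_int q)"
  have "(\<Sum>l=1..q. unit_exp (of_int l * of_int n / of_int q)) = (\<Sum>k=1..nat q. w ^ k)"
    by (rule sum.reindex_bij_witness[of _ int nat])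
       (use q in \<open>auto simp: w_def unit_exp_power\<close>)
  also have "\<dots> = (\<Sum>k<nat q. w ^ Suc k)"
    by (rule sum.reindex_bij_witness[of _ Suc "\<lambda>k. k - 1"]) auto
  also have "\<dots> = w * (\<Sum>k<nat q. w ^ k)"
    by (simp add: sum_distrib_left)
  also have "\<dots> = (if q dvd n then of_int q else 0)"
  proof (cases "q dvd n")
    case True
    then obtain k where "n = q * k" ..
    then have "w = unit_exp (of_int k)" using q by (simp add: w_def)
    then have "w = 1" by simp
    then show ?thesis using True q by simp
  next
    case False
    have "w \<noteq> 1"
    proof
      assume "w = 1"
      then obtain k :: int where "of_int n / of_int q = (of_int k :: real)"
        unfolding w_def using unit_exp_eq_1_imp_Ints by (blast elim: Ints_cases)
      then have "real_of_int n = real_of_int (q * k)" using q by (simp add: field_simps)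
      then have "n = q * k" by linarith
      with False show False by simp
    qed
    moreover have "w ^ nat q = 1"
    proof -
      have "w ^ nat q = unit_exp (of_int n)"
        using q by (simp add: w_def unit_exp_power)
      then show ?thesis by simp
    qed
    ultimately show ?thesis using False by (simp add: sum_gp_strict)
  qed
  finally show ?thesis .
qed

section \<open>Fourier series of the sawtooth\<close>

text \<open>The value 0 at integers is the midpoint of the jump, which is the limit of the symmetric
  Fourier sums there. It is the source of the halved term in the primed sum.\<close>

definition sawtooth :: "real \<Rightarrow> real" where
  "sawtooth x = (if x \<in> \<int> then 0 else frac x - 1/2)"

text \<open>The term for \<open>n = 0\<close> vanishes, by division by zero.\<close>

definition fourier_term :: "real \<Rightarrow> int \<Rightarrow> complex" where
  "fourier_term x n = - unit_exp (of_int n * x) / (2 * of_real pi * \<i> * of_int n)"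

lemma sum_symmetric_int:
  fixes f :: "int \<Rightarrow> 'a :: comm_monoid_add"
  shows "(\<Sum>n=-int N..int N. f n) = f 0 + (\<Sum>k=1..N. f (int k) + f (- int k))"
proof (induction N)
  case (Suc N)
  have "{- int (Suc N)..int (Suc N)} = insert (int (Suc N)) (insert (- int (Suc N)) {-int N..int N})"
    by auto
  then show ?case using Suc by (simp add: ac_simps)
qed simp

text \<open>The denominators of the two terms have opposite signs, so the cosines cancel and the
  sines add.\<close>

lemma fourier_term_pair:
  "fourier_term x (int k) + fourier_term x (- int k)
    = of_real (- 1 / pi * (sin (real k * (2 * pi * x)) / real k))"
proof (cases "k = 0")
  case False
  have "unit_exp (of_int (int k) * x) - unit_exp (of_int (- int k) * x)
      = 2 * \<i> * of_real (sin (real k * (2 * pi * x)))"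
    by (simp add: unit_exp_def complex_eq_iff mult_ac)
  then have u: "unit_exp (of_int (int k) * x) = unit_exp (of_int (- int k) * x)
      + 2 * \<i> * of_real (sin (real k * (2 * pi * x)))"
    by (simp add: algebra_simps)
  show ?thesis unfolding fourier_term_def u using False
    by (simp add: field_simps)
qed (simp add: fourier_term_def)

lemma fourier_term_plus_int: "fourier_term (x + of_int j) n = fourier_term x n"
proof -
  have "unit_exp (of_int n * (x + of_int j)) = unit_exp (of_int n * x)"
    using unit_exp_of_int[of "n * j"] by (simp add: distrib_left unit_exp_add)
  then show ?thesis by (simp add: fourier_term_def)
qed

text \<open>By periodicity \<open>x\<close> may be replaced by its fractional part \<open>y\<close>.
  If \<open>y\<close> is 0, every sine vanishes; otherwise the sine series applies at
  \<open>2 * pi * y\<close>.\<close>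

lemma sawtooth_fourier:
  "(\<lambda>N. \<Sum>n=-int N..int N. fourier_term x n) \<longlonglongrightarrow> of_real (sawtooth x)"
proof -
  define y where "y = frac x"
  have y: "0 \<le> y" "y < 1" by (auto simp: y_def frac_lt_1)
  have xy: "x = y + of_int \<lfloor>x\<rfloor>" by (simp add: y_def frac_def)
  have "(\<Sum>n=-int N..int N. fourier_term x n)
      = of_real (- 1 / pi * (\<Sum>k=1..N. sin (real k * (2 * pi * y)) / real k))" for N
  proof -
    have "fourier_term x n = fourier_term y n" for n
      using fourier_term_plus_int[of y "\<lfloor>x\<rfloor>" n] by (simp only: xy[symmetric])
    then have "(\<Sum>n=-int N..int N. fourier_term x n) = (\<Sum>n=-int N..int N. fourier_term y n)"
      by simp
    also have "\<dots> = fourier_term y 0 + of_real (- 1 / pi * (\<Sum>k=1..N. sin (real k * (2 * pi * y)) / real k))"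
      unfolding sum_symmetric_int fourier_term_pair sum_distrib_left of_real_sum ..
    finally show ?thesis by (simp add: fourier_term_def)
  qed
  moreover have "(\<lambda>N. - 1 / pi * (\<Sum>k=1..N. sin (real k * (2 * pi * y)) / real k)) \<longlonglongrightarrow> sawtooth x"
  proof (cases "y = 0")
    case True
    then have "x \<in> \<int>" by (simp add: y_def)
    then show ?thesis by (simp add: sawtooth_def True)
  next
    case False
    with y have "(\<lambda>N. - 1 / pi * (\<Sum>k=1..N. sin (real k * (2 * pi * y)) / real k))
        \<longlonglongrightarrow> - 1 / pi * ((pi - 2 * pi * y) / 2)"
      by (intro tendsto_mult tendsto_const sine_series) auto
    also have "- 1 / pi * ((pi - 2 * pi * y) / 2) = sawtooth x"
      using False by (simp add: sawtooth_def y_def field_simps)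
    finally show ?thesis .
  qed
  ultimately show ?thesis by (simp only: tendsto_of_real)
qed

section \<open>The series as an average of shifted sawtooths\<close>

text \<open>No integer congruent to \<open>r\<close> modulo \<open>q\<close> is zero when
  \<open>0 < r < q\<close>, so the filter in the definition removes nothing.\<close>

lemma psi_partial_eq:
  assumes "0 < r" "r < q"
  shows "psi_partial u r q M = (\<Sum>m=-int M..int M. fourier_term u (m * q + r))"
proof -
  have nz: "m * q + r \<noteq> 0" for m
  proof
    assume "m * q + r = 0"
    then have "r = q * (- m)" by (simp add: algebra_simps)
    then have "q dvd r" by (rule dvdI)
    with assms show False by (auto dest: zdvd_imp_le)
  qed
  have e: "exp (2 * of_real pi * \<i> * of_int n * of_real u) = unit_exp (of_int n * u)" for n :: int
    by (simp add: unit_exp_def cis_conv_exp mult_ac)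
  have "{m. m \<in> {-int M..int M} \<and> m * q + r \<noteq> 0} = {-int M..int M}" using nz by auto
  then show ?thesis
    unfolding psi_partial_def e fourier_term_def by (simp add: sum_negf)
qed

text \<open>For \<open>0 < r < q\<close>, the \<open>n = m q + r\<close> with \<open>-M q \<le> n \<le> M q\<close> are those with
  \<open>-M \<le> m < M\<close>, so \<open>m = M\<close> is split off.\<close>

lemma psi_partial_eq_average:
  assumes r: "0 < r" "r < q"
  shows "psi_partial u r q M
    = 1 / of_int q * (\<Sum>l=1..q. unit_exp (of_int l * of_int r / of_int q)
         * (\<Sum>n=-int (M * nat q)..int (M * nat q). fourier_term (u - of_int l / of_int q) n))
      + fourier_term u (int M * q + r)"
proof -
  define A where "A = {-int (M * nat q)..int (M * nat q)}"
  have q: "q > 0" using r by simp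
  have A: "A = {- (int M * q)..int M * q}" using q by (simp add: A_def)
  have "(\<Sum>l=1..q. unit_exp (of_int l * of_int r / of_int q) * (\<Sum>n\<in>A. fourier_term (u - of_int l / of_int q) n))
      = (\<Sum>n\<in>A. \<Sum>l=1..q. unit_exp (of_int l * of_int r / of_int q) * fourier_term (u - of_int l / of_int q) n)"
    unfolding sum_distrib_left by (rule sum.swap)
  \<comment> \<open>Only the shift by \<open>l/q\<close> depends on \<open>l\<close>; pulling it out
    of the Fourier term leaves a character sum at \<open>r - n\<close>.\<close>
  also have "\<dots> = (\<Sum>n\<in>A. fourier_term u n * (\<Sum>l=1..q. unit_exp (of_int l * of_int (r - n) / of_int q)))"
  proof (intro sum.cong refl, unfold sum_distrib_left, intro sum.cong refl)
    fix n l
    have "unit_exp (of_int l * of_int r / of_int q) * unit_exp (of_int n * (u - of_int l / of_int q))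
        = unit_exp (of_int n * u) * unit_exp (of_int l * of_int (r - n) / of_int q)"
      unfolding unit_exp_add[symmetric] using q
      by (intro arg_cong[of _ _ unit_exp]) (simp add: field_simps)
    then show "unit_exp (of_int l * of_int r / of_int q) * fourier_term (u - of_int l / of_int q) n
        = fourier_term u n * unit_exp (of_int l * of_int (r - n) / of_int q)"
      by (simp add: fourier_term_def)
  qed
  also have "\<dots> = (\<Sum>n\<in>A. if q dvd r - n then of_int q * fourier_term u n else 0)"
    unfolding sum_unit_exp_eq[OF q] by (intro sum.cong) auto
  also have "\<dots> = (\<Sum>n | n \<in> A \<and> q dvd r - n. of_int q * fourier_term u n)"
    by (rule sum.inter_filter[symmetric]) (simp add: A)
  also have "\<dots> = (\<Sum>m=-int M..<int M. of_int q * fourier_term u (m * q + r))"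
  proof (rule sum.reindex_bij_witness[of _ "\<lambda>m. m * q + r" "\<lambda>n. (n - r) div q"])
    fix n assume "n \<in> {n. n \<in> A \<and> q dvd r - n}"
    then have n: "- (int M * q) \<le> n" "n \<le> int M * q" "q dvd n - r"
      by (auto simp: A dvd_diff_commute)
    then show eq: "(n - r) div q * q + r = n" by simp
    define m where "m = (n - r) div q"
    have nm: "n = m * q + r" using eq by (simp add: m_def)
    have "m * q < int M * q" using n nm r by linarith
    then have "m < int M" using q by simp
    moreover have "(- int M - 1) * q < m * q" using n nm r by (simp add: algebra_simps)
    then have "- int M - 1 < m" using q by (simp only: mult_less_cancel_right)
    ultimately show "(n - r) div q \<in> {-int M..<int M}" by (simp add: m_def)
  next
    fix m assume m: "m \<in> {-int M..<int M}"
    show "(m * q + r - r) div q = m" using q by simp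
    have "(m + 1) * q \<le> int M * q"
      using m q by (intro mult_right_mono) auto
    moreover have "(- int M) * q \<le> m * q"
      using m q by (intro mult_right_mono) auto
    ultimately
    have "- (int M * q) \<le> m * q + r" "m * q + r \<le> int M * q"
      using r by (auto simp: algebra_simps)
    then show "m * q + r \<in> {n. n \<in> A \<and> q dvd r - n}" by (simp add: A)
  next
    fix n assume "n \<in> {n. n \<in> A \<and> q dvd r - n}"
    then have "q dvd n - r" by (auto simp: dvd_diff_commute)
    then show "of_int q * fourier_term u ((n - r) div q * q + r) = of_int q * fourier_term u n"
      by simp
  qed
  also have "\<dots> = of_int q * (\<Sum>m=-int M..<int M. fourier_term u (m * q + r))"
    by (simp add: sum_distrib_left)
  finally have main: "1 / of_int q * (\<Sum>l=1..q. unit_exp (of_int l * of_int r / of_int q)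
         * (\<Sum>n\<in>A. fourier_term (u - of_int l / of_int q) n))
      = (\<Sum>m=-int M..<int M. fourier_term u (m * q + r))"
    using q by simp
  have "{-int M..int M} = insert (int M) {-int M..<int M}" by auto
  then have "psi_partial u r q M
      = (\<Sum>m=-int M..<int M. fourier_term u (m * q + r)) + fourier_term u (int M * q + r)"
    by (simp add: psi_partial_eq[OF r] add.commute)
  then show ?thesis using main by (simp add: A_def)
qed

text \<open>The inner sums are Fourier sums of the sawtooth taken along the subsequence
  \<open>M * q\<close>, and the split-off term is \<open>O(1/M)\<close> because its numerator has
  modulus 1.\<close>

lemma psi_partial_tendsto:
  assumes r: "0 < r" "r < q"
  shows "psi_partial u r q \<longlonglongrightarrow> 1 / of_int q * (\<Sum>l=1..q. unit_exp (of_int l * of_int r / of_int q)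
         * of_real (sawtooth (u - of_int l / of_int q)))"
proof -
  have q: "q > 0" using r by simp
  have sub: "filterlim (\<lambda>M. M * nat q) sequentially sequentially"
    using q by (intro filterlim_subseq) (auto simp: strict_mono_def)
  have last: "(\<lambda>M. fourier_term u (int M * q + r)) \<longlonglongrightarrow> 0"
  proof (rule Lim_null_comparison)
    show "(\<lambda>M. 1 / real M) \<longlonglongrightarrow> 0" by (rule lim_1_over_n)
    show "\<forall>\<^sub>F M in sequentially. norm (fourier_term u (int M * q + r)) \<le> 1 / real M"
    proof (intro eventually_sequentiallyI[of 1])
      fix M :: nat assume M: "1 \<le> M"
      have "int M * 1 \<le> int M * q" using q by (intro mult_left_mono) auto
      then have le: "int M \<le> int M * q + r" using r by simp
      then have pos: "int M * q + r > 0" using M by linarith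
      define p where "p = real_of_int (int M * q + r)"
      have p: "p > 0" using pos unfolding p_def by (simp only: of_int_0_less_iff)
      have Mp: "real M \<le> p"
        using le unfolding p_def of_int_of_nat_eq[symmetric, where ?'a = real]
        by (simp only: of_int_le_iff)
      have "norm (fourier_term u (int M * q + r)) = 1 / (2 * pi * p)"
        unfolding fourier_term_def norm_divide norm_minus_cancel norm_mult norm_unit_exp
          norm_of_real norm_of_int p_def[symmetric]
        using p by simp
      also have "\<dots> \<le> 1 / real M"
      proof (rule divide_left_mono)
        have "1 * p \<le> 2 * pi * p"
          using p pi_gt3 by (intro mult_right_mono) linarith+
        with Mp show "real M \<le> 2 * pi * p" by simp
        show "0 < 2 * pi * p * real M" using p M by simp
      qed simp
      finally show "norm (fourier_term u (int M * q + r)) \<le> 1 / real M" .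
    qed
  qed
  have "(\<lambda>M. 1 / of_int q * (\<Sum>l=1..q. unit_exp (of_int l * of_int r / of_int q)
         * (\<Sum>n=-int (M * nat q)..int (M * nat q). fourier_term (u - of_int l / of_int q) n))
      + fourier_term u (int M * q + r))
    \<longlonglongrightarrow> 1 / of_int q * (\<Sum>l=1..q. unit_exp (of_int l * of_int r / of_int q)
         * of_real (sawtooth (u - of_int l / of_int q))) + 0"
    by (intro tendsto_intros last filterlim_compose[OF sawtooth_fourier sub])
  then show ?thesis by (simp only: psi_partial_eq_average[OF r, symmetric] add_0_right)
qed

lemma psi_eq_sawtooth_sum:
  assumes "0 < r" "r < q"
  shows "psi u r q = 1 / of_int q * (\<Sum>l=1..q. unit_exp (of_int l * of_int r / of_int q)
         * of_real (sawtooth (u - of_int l / of_int q)))"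
  unfolding psi_def by (rule limI[OF psi_partial_tendsto[OF assms]])

section \<open>The constant as the value at \<open>u = 0\<close>\<close>

text \<open>Pairing \<open>m\<close> with \<open>-m\<close> turns the conditionally convergent
  series of reciprocals into one with quadratic denominators.\<close>

lemma psi_partial_0:
  assumes r: "0 < r" "r < q"
  shows "psi_partial 0 r q M = - (1 / (2 * of_real pi * \<i>)) *
      (1 / of_int r - 2 * of_int r *
        (\<Sum>m<M. 1 / (of_nat (Suc m) ^ 2 * of_int q ^ 2 - of_int r ^ 2)))"
proof -
  have pair: "1 / (of_int k * of_int q + of_int r) + 1 / (- of_int k * of_int q + of_int r)
      = - 2 * of_int r * (1 / (of_int k ^ 2 * of_int q ^ 2 - of_int r ^ 2) :: complex)"
    if k: "k > 0" for k :: int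
  proof -
    have "1 * q \<le> k * q" using k r by (intro mult_right_mono) auto
    then have "k * q + r \<noteq> 0" "r - k * q \<noteq> 0" using r by linarith+
    then have "of_int (k * q + r) \<noteq> (0 :: complex)" "of_int (r - k * q) \<noteq> (0 :: complex)"
      by (simp_all only: of_int_eq_0_iff not_False_eq_True)
    moreover define a b :: complex where "a = of_int k * of_int q" and "b = of_int r"
    ultimately have nz: "a + b \<noteq> 0" "b - a \<noteq> 0" "a - b \<noteq> 0" by auto
    have fac: "of_int k ^ 2 * of_int q ^ 2 - of_int r ^ 2 = - ((a + b) * (b - a))"
      by (simp add: a_def b_def power2_eq_square algebra_simps)
    have "1 / (a + b) + 1 / (b - a) = - 2 * b * (1 / (- ((a + b) * (b - a))))"
      using nz by (simp add: divide_simps)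
    then show ?thesis unfolding fac by (simp add: a_def b_def)
  qed
  have ft: "fourier_term 0 n = - (1 / (2 * of_real pi * \<i>)) * (1 / of_int n)" for n
    by (simp add: fourier_term_def)
  have "psi_partial 0 r q M
      = - (1 / (2 * of_real pi * \<i>)) * (\<Sum>m=-int M..int M. 1 / of_int (m * q + r))"
    unfolding psi_partial_eq[OF r] ft sum_distrib_left ..
  also have "(\<Sum>m=-int M..int M. 1 / of_int (m * q + r) :: complex)
      = 1 / of_int r + (\<Sum>k=1..M. - 2 * of_int r * (1 / (of_nat k ^ 2 * of_int q ^ 2 - of_int r ^ 2)))"
    unfolding sum_symmetric_int
  proof (intro arg_cong2[of _ _ _ _ "(+)"] sum.cong refl)
    fix k assume "k \<in> {1..M}"
    then show "1 / of_int (int k * q + r) + 1 / of_int (- int k * q + r)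
        = - 2 * of_int r * (1 / (of_nat k ^ 2 * of_int q ^ 2 - of_int r ^ 2) :: complex)"
      using pair[of "int k"] by simp
  qed simp
  also have "\<dots> = 1 / of_int r - 2 * of_int r * (\<Sum>k=1..M. 1 / (of_nat k ^ 2 * of_int q ^ 2 - of_int r ^ 2))"
    unfolding sum_distrib_left[symmetric] by simp
  also have "(\<Sum>k=1..M. 1 / (of_nat k ^ 2 * of_int q ^ 2 - of_int r ^ 2) :: complex)
      = (\<Sum>m<M. 1 / (of_nat (Suc m) ^ 2 * of_int q ^ 2 - of_int r ^ 2))"
    by (rule sum.reindex_bij_witness[of _ Suc "\<lambda>k. k - 1"]) auto
  finally show ?thesis .
qed

text \<open>No comparison test is used: the partial sums of \<open>f\<close> are an affine function
  of \<open>psi_partial 0 r q\<close>, whose convergence is already known, and this gives both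
  summability and the value.\<close>

lemma c_const_sums:
  fixes q r :: int
  assumes r: "0 < r" "r < q"
  defines "f \<equiv> \<lambda>m. 1 / (of_nat (Suc m) ^ 2 * of_int q ^ 2 - of_int r ^ 2) :: complex"
  shows "summable f" and "psi 0 r q = c_const r q"
proof -
  define K :: complex where "K = - (1 / (2 * of_real pi * \<i>))"
  have lim0: "psi_partial 0 r q \<longlonglongrightarrow> psi 0 r q"
    unfolding psi_eq_sawtooth_sum[OF r] by (rule psi_partial_tendsto[OF r])
  have P: "psi_partial 0 r q M = K * (1 / of_int r - 2 * of_int r * sum f {..<M})" for M
    unfolding psi_partial_0[OF r] K_def f_def ..
  have "K \<noteq> 0" by (simp add: K_def)
  then have S: "sum f {..<M} = (1 / of_int r - psi_partial 0 r q M / K) / (2 * of_int r)" for M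
    unfolding P using r by (simp add: field_simps)
  have "(\<lambda>M. sum f {..<M}) \<longlonglongrightarrow> (1 / of_int r - psi 0 r q / K) / (2 * of_int r)"
    unfolding S using r \<open>K \<noteq> 0\<close> by (intro tendsto_intros lim0) auto
  then have sums: "f sums ((1 / of_int r - psi 0 r q / K) / (2 * of_int r))"
    by (simp add: sums_def)
  then show "summable f" by (rule sums_summable)
  have "suminf f = (1 / of_int r - psi 0 r q / K) / (2 * of_int r)"
    using sums by (rule sums_unique[symmetric])
  then have "psi 0 r q = K * (1 / of_int r - 2 * of_int r * suminf f)"
    using r \<open>K \<noteq> 0\<close> by (simp add: field_simps)
  then show "psi 0 r q = c_const r q" by (simp add: c_const_def K_def f_def)
qed

section \<open>The closed formula on the period \<open>0 < u <= 1\<close>\<close>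

text \<open>The summand \<open>1/2\<close> at \<open>l = q\<close> is half the jump of the sawtooth at the origin, and gives rise to the
  leading \<open>1/2\<close> in the formula for \<open>psi\<close>.\<close>

lemma sawtooth_diff:
  fixes q l :: int
  assumes l: "1 \<le> l" "l \<le> q" and u: "0 < u" "u \<le> 1"
  shows "sawtooth (u - of_int l / of_int q) - sawtooth (0 - of_int l / of_int q)
    = u - (if l = q then 1/2 else 0)
        - (if of_int l \<le> of_int q * u then (if of_int l = of_int q * u then 1/2 else 1) else 0)"
proof -
  define y :: real where "y = of_int l / of_int q"
  have q: "q > 0" using l by simp
  have y: "0 < y" "y \<le> 1" using l by (auto simp: y_def)
  have conv: "l = q \<longleftrightarrow> y = 1" "of_int l \<le> of_int q * u \<longleftrightarrow> y \<le> u" "of_int l = of_int q * u \<longleftrightarrow> y = u"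
    using q by (auto simp: y_def field_simps)
  \<comment> \<open>All arguments that occur lie in the interval from -1 to 1, so the floors
    \<open>-1\<close> and \<open>0\<close> suffice.\<close>
  have saw: "sawtooth x = (if x = of_int n then 0 else x - of_int n - 1/2)"
    if "of_int n \<le> x" "x < of_int n + 1" for x :: real and n :: int
  proof -
    have fl: "\<lfloor>x\<rfloor> = n" using that by linarith
    then have "x \<in> \<int> \<longleftrightarrow> x = of_int n" by (metis Ints_of_int floor_of_int Ints_cases)
    then show ?thesis by (simp add: sawtooth_def frac_def fl)
  qed
  have "sawtooth (0 - y) = (if y = 1 then 0 else 1/2 - y)"
    using saw[of "-1" "0 - y"] y by auto
  moreover have "sawtooth (u - y) = (if y = u then 0 else if y < u then u - y - 1/2 else u - y + 1/2)"
    using saw[of 0 "u - y"] saw[of "-1" "u - y"] y u by auto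
  ultimately show ?thesis unfolding y_def[symmetric] conv using y u by auto
qed

text \<open>Subtracting the value at 0, which is \<open>c_const r q\<close>, leaves only differences
  of sawtooths, given termwise by \<open>sawtooth_diff\<close>.\<close>

lemma psi_eq_primed_sum:
  assumes r: "0 < r" "r < q" and u: "0 < u" "u \<le> 1"
  shows "psi u r q = c_const r q - 1 / of_int q * (1 / 2 + primed_sum u r q)"
proof -
  have q: "q > 0" using r by simp
  define z where "z l = unit_exp (of_int l * of_int r / of_int q)" for l :: int
  define w :: "int \<Rightarrow> real" where
    "w l = (if of_int l \<le> of_int q * u then (if of_int l = of_int q * u then 1/2 else 1) else 0)" for l
  have "\<not> q dvd r" using r by (auto dest: zdvd_imp_le)
  then have z0: "(\<Sum>l=1..q. z l) = 0" using sum_unit_exp_eq[OF q, of r] by (simp add: z_def)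
  have zq: "z q = 1" using q by (simp add: z_def)
  have primed: "primed_sum u r q = (\<Sum>l=1..q. z l * of_real (w l))"
  proof -
    have ez: "exp (2 * of_real pi * \<i> * of_int l * of_int r / of_int q) = z l" for l
      by (simp add: z_def unit_exp_def cis_conv_exp mult_ac)
    \<comment> \<open>Here \<open>u <= 1\<close> confines the primed sum to a single residue system
      modulo \<open>q\<close>.\<close>
    have "l \<le> q" if "of_int l \<le> of_int q * u" for l
    proof -
      have "of_int q * u \<le> of_int q * 1" using q u by (intro mult_left_mono) auto
      then show ?thesis using that by linarith
    qed
    then have set: "{l. 1 \<le> l \<and> of_int l \<le> of_int q * u} = {l \<in> {1..q}. of_int l \<le> of_int q * u}"
      by auto
    show ?thesis unfolding primed_sum_def ez set
      by (subst sum.inter_filter) (auto intro!: sum.cong simp: w_def)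
  qed
  have "psi u r q - psi 0 r q = 1 / of_int q * (\<Sum>l=1..q. z l *
      of_real (sawtooth (u - of_int l / of_int q) - sawtooth (0 - of_int l / of_int q)))"
    unfolding psi_eq_sawtooth_sum[OF r] z_def
    by (simp only: right_diff_distrib[symmetric] sum_subtractf[symmetric] of_real_diff)
  also have "(\<Sum>l=1..q. z l *
        of_real (sawtooth (u - of_int l / of_int q) - sawtooth (0 - of_int l / of_int q)))
      = (\<Sum>l=1..q. of_real u * z l - (if l = q then z l * (1/2) else 0) - z l * of_real (w l))"
  proof (intro sum.cong refl)
    fix l assume "l \<in> {1..q}"
    then have eq: "sawtooth (u - of_int l / of_int q) - sawtooth (0 - of_int l / of_int q)
        = u - (if l = q then 1/2 else 0) - w l"
      unfolding w_def using u by (intro sawtooth_diff) auto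
    show "z l * of_real (sawtooth (u - of_int l / of_int q) - sawtooth (0 - of_int l / of_int q))
        = of_real u * z l - (if l = q then z l * (1/2) else 0) - z l * of_real (w l)"
      unfolding eq by (simp add: algebra_simps)
  qed
  \<comment> \<open>The part linear in \<open>u\<close> is killed by \<open>z0\<close>, and the term
    \<open>l = q\<close> contributes \<open>z q / 2 = 1/2\<close>.\<close>
  also have "\<dots> = - (1 / 2 + primed_sum u r q)"
    using q by (simp add: sum_subtractf sum_distrib_left[symmetric] z0 zq primed)
  finally show ?thesis by (simp add: c_const_sums(2)[OF r] algebra_simps)
qed

section \<open>The step function property\<close>

text \<open>None of the shifted sawtooths jumps strictly between consecutive multiples of
  \<open>1/q\<close>, so each is \<open>u\<close> plus a constant there, and the multiples of
  \<open>u\<close> cancel.\<close>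

lemma psi_constant_on:
  assumes r: "0 < r" "r < q"
  shows "(\<lambda>u. psi u r q) constant_on {of_int k / of_int q<..<(of_int k + 1) / of_int q}"
proof -
  have q: "q > 0" using r by simp
  define z where "z l = unit_exp (of_int l * of_int r / of_int q)" for l :: int
  \<comment> \<open>The integer \<open>(k - l) div q\<close> is the floor of \<open>u - l/q\<close>
    for every \<open>u\<close> in the interval.\<close>
  define d :: "int \<Rightarrow> real" where "d l = - of_int l / of_int q - of_int ((k - l) div q) - 1/2" for l :: int
  have "\<not> q dvd r" using r by (auto dest: zdvd_imp_le)
  then have z0: "(\<Sum>l=1..q. z l) = 0" using sum_unit_exp_eq[OF q, of r] by (simp add: z_def)
  have "psi u r q = 1 / of_int q * (\<Sum>l=1..q. z l * of_real (d l))"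
    if u: "u \<in> {of_int k / of_int q<..<(of_int k + 1) / of_int q}" for u
  proof -
    have saw: "sawtooth (u - of_int l / of_int q) = u + d l" for l
    proof -
      define j where "j = (k - l) div q"
      define x where "x = u - of_int l / of_int q"
      have qx: "of_int q * x = of_int q * u - of_int l" using q by (simp add: x_def field_simps)
      have ku: "of_int k < of_int q * u" "of_int q * u < of_int k + 1"
        using u q by (auto simp: field_simps)
      have "q * j \<le> k - l" "k - l + 1 \<le> q * (j + 1)"
        using pos_mod_bound[OF q, of "k - l"] pos_mod_sign[OF q, of "k - l"]
          mult_div_mod_eq[of q "k - l"] unfolding j_def distrib_left by linarith+
      then have "real_of_int (q * j) \<le> of_int (k - l)" "real_of_int (k - l + 1) \<le> of_int (q * (j + 1))"
        by (simp_all only: of_int_le_iff)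
      then have "of_int q * of_int j < of_int q * x" "of_int q * x < of_int q * (of_int j + 1)"
        using ku unfolding qx by simp_all
      then have jx: "of_int j < x" "x < of_int j + 1" using q by simp_all
      then have fl: "\<lfloor>x\<rfloor> = j" by linarith
      then have "x \<notin> \<int>" using jx by (auto elim!: Ints_cases)
      then have "sawtooth x = x - of_int j - 1/2" by (simp add: sawtooth_def frac_def fl)
      then show ?thesis by (simp add: x_def d_def j_def)
    qed
    have "(\<Sum>l=1..q. z l * of_real (u + d l)) = of_real u * (\<Sum>l=1..q. z l) + (\<Sum>l=1..q. z l * of_real (d l))"
      by (simp add: sum_distrib_left sum.distrib[symmetric] algebra_simps)
    then show ?thesis by (simp add: psi_eq_sawtooth_sum[OF r] saw z0 z_def[symmetric])
  qed
  then show ?thesis unfolding constant_on_def by blast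
qed

lemma step_function_if_constant_between_multiples:
  fixes f :: "real \<Rightarrow> 'a" and q :: real
  assumes q: "q > 0"
    and const: "\<And>k :: int. f constant_on {of_int k / q<..<(of_int k + 1) / q}"
  shows "step_function f"
  unfolding step_function_def
proof (intro allI impI)
  fix a b :: real assume ab: "a < b"
  define k where "k = \<lfloor>q * a\<rfloor>"
  \<comment> \<open>With this \<open>n\<close> the point \<open>(k + n - 1) / q\<close> is the last
    multiple of \<open>1/q\<close> strictly below \<open>b\<close>. The partition consists of
    \<open>a\<close>, the multiples of \<open>1/q\<close> strictly between \<open>a\<close> and
    \<open>b\<close>, and \<open>b\<close>.\<close>
  define n where "n = nat (\<lceil>q * b\<rceil> - k)"
  define t where "t i = (if i = 0 then a else if i = n then b else (of_int k + real i) / q)" for i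
  have qab: "q * a < q * b" using ab q by simp
  have k: "of_int k \<le> q * a" "q * a < of_int k + 1" unfolding k_def by linarith+
  have "k < \<lceil>q * b\<rceil>" using k qab by linarith
  then have n: "n > 0" "of_int k + real n = of_int \<lceil>q * b\<rceil>" by (auto simp: n_def)
  have kn: "q * b \<le> of_int k + real n" "of_int k + real n < q * b + 1"
    unfolding n by linarith+
  have lower: "(of_int k + real i) / q \<le> t i" if "i < n" for i
    using that k q by (auto simp: t_def field_simps)
  have upper: "t (Suc i) \<le> (of_int k + real (Suc i)) / q" for i
    using kn q by (auto simp: t_def field_simps)
  have qt: "q * t i = (if i = 0 then q * a else if i = n then q * b else of_int k + real i)" for i
    using q by (simp add: t_def)
  have "t i < t (Suc i) \<and> f constant_on {t i<..<t (Suc i)}" if i: "i < n" for i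
  proof
    have "q * t i < q * t (Suc i)"
    proof -
      have "real (Suc i) \<le> real n" using i by simp
      moreover have "Suc i \<noteq> n \<Longrightarrow> real (Suc i) + 1 \<le> real n" using i by linarith
      ultimately show ?thesis using k kn i qab by (cases "i = 0") (auto simp: qt)
    qed
    then show "t i < t (Suc i)" using q by simp
    have "{t i<..<t (Suc i)} \<subseteq> {of_int (k + int i) / q<..<(of_int (k + int i) + 1) / q}"
      using lower[OF i] upper[of i] by (auto simp: add.commute add.left_commute)
    then show "f constant_on {t i<..<t (Suc i)}"
      by (rule constant_on_subset[OF const])
  qed
  then show "\<exists>n t. t 0 = a \<and> t n = b \<and> (\<forall>i<n. t i < t (Suc i) \<and> f constant_on {t i<..<t (Suc i)})"
    using n by (intro exI[of _ n] exI[of _ t]) (auto simp: t_def)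
qed

theorem theorem3:
  fixes q r :: int
  assumes "q \<ge> 2" and "1 \<le> r" and "r \<le> q - 1"
  shows "(\<forall>u. convergent (psi_partial u r q)) \<and>
    summable (\<lambda>m. 1 / (of_nat (Suc m) ^ 2 * of_int q ^ 2 - of_int r ^ 2) :: complex) \<and>
    (\<forall>u. psi (u + 1) r q = psi u r q) \<and>
    step_function (\<lambda>u. psi u r q) \<and>
    (\<forall>u. 0 < u \<and> u \<le> 1 \<longrightarrow>
      psi u r q = c_const r q - 1 / of_int q * (1 / 2 + primed_sum u r q))"
proof -
  have r: "0 < r" "r < q" and q: "real_of_int q > 0" using assms by auto
  \<comment> \<open>Periodicity holds already for each partial sum, since all frequencies are
    integers.\<close>
  have "psi_partial (u + 1) r q = psi_partial u r q" for u
    using fourier_term_plus_int[of u 1] by (simp add: psi_partial_eq[OF r] fun_eq_iff)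
  then have "psi (u + 1) r q = psi u r q" for u
    by (simp add: psi_def)
  moreover have "convergent (psi_partial u r q)" for u
    using psi_partial_tendsto[OF r] by (auto simp: convergent_def)
  moreover have "step_function (\<lambda>u. psi u r q)"
    by (rule step_function_if_constant_between_multiples[OF q psi_constant_on[OF r]])
  ultimately show ?thesis
    using c_const_sums(1)[OF r] psi_eq_primed_sum[OF r] by blast
qed

end
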